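(* Let $d\in\mathbb{N}$, let $F_d$ be the free group with basis $x_1,\ldots,x_d$, let $w\in F_d$, and let $\gamma$ be an anti-automorphism of $F_d$. Then $w$ is chiral if and only if $w$ is $\gamma$-chiral.
   Context: For a group $G$ and a word $w\in F_d$ (an element of the free group $F_d$ with basis $x_1,\ldots,x_d$), the word map $w:G^d\to G$ is the evaluation map sending $(g_1,\ldots,g_d)$ to $w(g_1,\ldots,g_d)$, the image of $w$ under the homomorphism $F_d\to G$ with $x_i\mapsto g_i$. Its image $w(G^d)$ is denoted $G_w$. An anti-automorphism of a group $H$ is a bijection $\delta:H\to H$ such that $\delta(ab)=\delta(b)\delta(a)$ for all $a,b\in H$. For an anti-automorphism $\gamma$ of $F_d$, a word $w\in F_d$ is called $\gamma$-chiral if there exists a group $G$ such that $G_w\neq G_{\gamma(w)}$. A word $w\in F_d$ is called chiral if it is $\gamma$-chiral for the anti-automorphism $\gamma(u)=u^{-1}$ of $F_d$, i.e. if there exists a group $G$ such that $G_w\neq G_{w^{-1}}$ (equivalently, $G_w$ is not closed under inversion). *)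

theory Defs
  imports "HOL-Algebra.Coset" "HOL-Library.Countable_Set"
begin

section \<open>The free group on \<open>x\<^sub>1, \<dots>, x\<^sub>d\<close>\<close>

text \<open>The letter \<open>(i, True)\<close> stands for \<open>x\<^sub>i\<close> and \<open>(i, False)\<close> for its inverse.  The elements of
  the free group are the reduced words, multiplied by concatenation followed by cancellation.\<close>

type_synonym letter = "nat \<times> bool"

definition inv_letter :: "letter \<Rightarrow> letter" where
  "inv_letter a = (fst a, \<not> snd a)"

definition reduced :: "letter list \<Rightarrow> bool" where
  "reduced = successively (\<lambda>a b. b \<noteq> inv_letter a)"

definition cancel_cons :: "letter \<Rightarrow> letter list \<Rightarrow> letter list" where
  "cancel_cons a u = (case u of [] \<Rightarrow> [a] | b # v \<Rightarrow> if b = inv_letter a then v else a # u)"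

definition free_group :: "nat \<Rightarrow> letter list monoid" where
  "free_group d =
     \<lparr> carrier = {u. reduced u \<and> fst ` set u \<subseteq> {1..d}},
       mult = (\<lambda>u v. foldr cancel_cons u v),
       one = [] \<rparr>"

definition basis_elt :: "nat \<Rightarrow> letter list" where
  "basis_elt i = [(i, True)]"


section \<open>Word maps\<close>

text \<open>\<open>word_eval G g\<close> is the homomorphism from the free group to \<open>G\<close> with \<open>x\<^sub>i \<mapsto> g i\<close>;
  see \<open>word_eval_hom\<close>, \<open>word_eval_basis\<close> and \<open>word_eval_unique\<close> below.\<close>

definition letter_eval :: "('g, 'm) monoid_scheme \<Rightarrow> (nat \<Rightarrow> 'g) \<Rightarrow> letter \<Rightarrow> 'g" where
  "letter_eval G g a = (if snd a then g (fst a) else inv\<^bsub>G\<^esub> (g (fst a)))"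

definition word_eval :: "('g, 'm) monoid_scheme \<Rightarrow> (nat \<Rightarrow> 'g) \<Rightarrow> letter list \<Rightarrow> 'g" where
  "word_eval G g w = foldr (\<lambda>a y. letter_eval G g a \<otimes>\<^bsub>G\<^esub> y) w \<one>\<^bsub>G\<^esub>"

definition word_image :: "('g, 'm) monoid_scheme \<Rightarrow> nat \<Rightarrow> letter list \<Rightarrow> 'g set" where
  "word_image G d w = (\<lambda>g. word_eval G g w) ` ({1..d} \<rightarrow>\<^sub>E carrier G)"


section \<open>Chirality\<close>

definition anti_automorphism :: "('h, 'm) monoid_scheme \<Rightarrow> ('h \<Rightarrow> 'h) \<Rightarrow> bool" where
  "anti_automorphism H \<delta> \<longleftrightarrow>
     bij_betw \<delta> (carrier H) (carrier H) \<and>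
     (\<forall>a\<in>carrier H. \<forall>b\<in>carrier H. \<delta> (a \<otimes>\<^bsub>H\<^esub> b) = \<delta> b \<otimes>\<^bsub>H\<^esub> \<delta> a)"

text \<open>HOL cannot quantify over types inside a formula, so the type \<open>'g\<close> of the elements of the
  groups considered is a parameter.  By \<open>gamma_chiral_infinite_type\<close> below, a group on any
  type whatsoever that witnesses chirality yields one on each infinite type, so that for infinite
  \<open>'g\<close> the notion does not depend on \<open>'g\<close> and means that a witnessing group exists at all.\<close>

definition gamma_chiral ::
    "'g itself \<Rightarrow> nat \<Rightarrow> (letter list \<Rightarrow> letter list) \<Rightarrow> letter list \<Rightarrow> bool" where
  "gamma_chiral (TYPE('g)) d \<gamma> w \<longleftrightarrow>
     (\<exists>G :: 'g monoid. group G \<and> word_image G d w \<noteq> word_image G d (\<gamma> w))"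

definition chiral :: "'g itself \<Rightarrow> nat \<Rightarrow> letter list \<Rightarrow> bool" where
  "chiral (TYPE('g)) d w \<longleftrightarrow> gamma_chiral (TYPE('g)) d (\<lambda>u. inv\<^bsub>free_group d\<^esub> u) w"


section \<open>The free group is a group\<close>

lemma inv_letter_inv_letter [simp]: "inv_letter (inv_letter a) = a"
  by (simp add: inv_letter_def)

lemma fst_inv_letter [simp]: "fst (inv_letter a) = fst a"
  by (simp add: inv_letter_def)

lemma reduced_Nil [simp]: "reduced []"
  by (simp add: reduced_def)

lemma reduced_Cons: "reduced (a # u) \<longleftrightarrow> reduced u \<and> (u = [] \<or> hd u \<noteq> inv_letter a)"
  by (cases u) (auto simp: reduced_def)

lemma reduced_cancel_cons: "reduced u \<Longrightarrow> reduced (cancel_cons a u)"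
  by (cases u) (auto simp: cancel_cons_def reduced_Cons)

lemma reduced_foldr: "reduced v \<Longrightarrow> reduced (foldr cancel_cons u v)"
  by (induction u) (auto simp: reduced_cancel_cons)

lemma cancel_cons_inv: "reduced u \<Longrightarrow> cancel_cons a (cancel_cons (inv_letter a) u) = u"
  by (cases u; cases "tl u") (auto simp: cancel_cons_def reduced_Cons)

lemma cancel_cons_inv': "reduced u \<Longrightarrow> cancel_cons (inv_letter a) (cancel_cons a u) = u"
  using cancel_cons_inv[of u "inv_letter a"] by simp

lemma letters_cancel_cons:
  "fst a \<in> I \<Longrightarrow> fst ` set u \<subseteq> I \<Longrightarrow> fst ` set (cancel_cons a u) \<subseteq> I"
  by (cases u) (auto simp: cancel_cons_def)

lemma letters_foldr:
  "fst ` set u \<subseteq> I \<Longrightarrow> fst ` set v \<subseteq> I \<Longrightarrow> fst ` set (foldr cancel_cons u v) \<subseteq> I"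
proof (induction u)
  case (Cons a u)
  then show ?case using letters_cancel_cons[of a I "foldr cancel_cons u v"] by simp
qed simp

lemma foldr_cancel_cons:
  assumes "reduced v"
  shows "foldr cancel_cons (cancel_cons a u) v = cancel_cons a (foldr cancel_cons u v)"
proof (cases u)
  case (Cons b u')
  then show ?thesis
    using cancel_cons_inv[OF reduced_foldr[OF assms], of a u'] by (simp add: cancel_cons_def[of a "b # u'"])
qed (simp add: cancel_cons_def)

lemma foldr_cancel_assoc:
  "reduced v \<Longrightarrow>
     foldr cancel_cons (foldr cancel_cons u u') v = foldr cancel_cons u (foldr cancel_cons u' v)"
  by (induction u) (auto simp: foldr_cancel_cons)

lemma foldr_cancel_Nil: "reduced u \<Longrightarrow> foldr cancel_cons u [] = u"
  by (induction u) (auto simp: reduced_Cons cancel_cons_def split: list.splits)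

lemma foldr_cancel_inverse:
  "reduced v \<Longrightarrow> foldr cancel_cons (rev (map inv_letter u)) (foldr cancel_cons u v) = v"
  by (induction u) (auto simp: cancel_cons_inv' reduced_foldr)

lemma free_group_group: "group (free_group d)"
proof (rule groupI)
  show "\<exists>v\<in>carrier (free_group d). v \<otimes>\<^bsub>free_group d\<^esub> u = \<one>\<^bsub>free_group d\<^esub>"
    if u: "u \<in> carrier (free_group d)" for u
  proof
    let ?v = "foldr cancel_cons (rev (map inv_letter u)) []"
    have "fst ` set (rev (map inv_letter u)) \<subseteq> {1..d}"
      using u by (auto simp: free_group_def)
    from letters_foldr[OF this, of "[]"] show "?v \<in> carrier (free_group d)"
      by (simp add: free_group_def reduced_foldr)
    show "?v \<otimes>\<^bsub>free_group d\<^esub> u = \<one>\<^bsub>free_group d\<^esub>"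
      using u foldr_cancel_inverse[of "[]" u]
      by (simp add: free_group_def foldr_cancel_assoc foldr_cancel_Nil)
  qed
qed (use letters_foldr in \<open>auto simp: free_group_def reduced_foldr foldr_cancel_assoc\<close>)

lemma basis_elt_in_carrier: "i \<in> {1..d} \<Longrightarrow> basis_elt i \<in> carrier (free_group d)"
  by (simp add: basis_elt_def free_group_def reduced_Cons)

lemma inv_basis_elt:
  assumes "i \<in> {1..d}"
  shows "inv\<^bsub>free_group d\<^esub> (basis_elt i) = [(i, False)]"
proof -
  interpret F: group "free_group d" by (rule free_group_group)
  show ?thesis
    using assms
    by (intro F.inv_equality)
       (auto simp: basis_elt_def free_group_def reduced_Cons cancel_cons_def inv_letter_def)
qed

lemma anti_automorphism_inv: "group H \<Longrightarrow> anti_automorphism H (\<lambda>u. inv\<^bsub>H\<^esub> u)"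
  unfolding anti_automorphism_def
  by (auto simp: group.inv_mult_group intro!: bij_betwI[where g = "\<lambda>u. inv\<^bsub>H\<^esub> u"])


section \<open>The universal property\<close>

context
  fixes G :: "('g, 'm) monoid_scheme" (structure)
    and d :: nat and g :: "nat \<Rightarrow> 'g"
  assumes G: "group G" and g: "g \<in> {1..d} \<rightarrow> carrier G"
begin

interpretation group G by (rule G)

lemma letter_eval_closed: "fst a \<in> {1..d} \<Longrightarrow> letter_eval G g a \<in> carrier G"
  using g by (auto simp: letter_eval_def)

lemma word_eval_closed: "fst ` set u \<subseteq> {1..d} \<Longrightarrow> word_eval G g u \<in> carrier G"
  by (induction u) (auto simp: word_eval_def letter_eval_closed simp del: atLeastAtMost_iff)

lemma word_eval_cancel_cons:
  assumes "fst a \<in> {1..d}" "fst ` set u \<subseteq> {1..d}"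
  shows "word_eval G g (cancel_cons a u) = letter_eval G g a \<otimes> word_eval G g u"
proof (cases u)
  case (Cons b v)
  have v: "word_eval G g v \<in> carrier G"
    using assms Cons by (intro word_eval_closed) simp
  have a: "letter_eval G g a \<in> carrier G"
    using assms(1) by (rule letter_eval_closed)
  have ia: "letter_eval G g (inv_letter a) = inv (letter_eval G g a)"
    using funcset_mem[OF g assms(1)] by (simp add: letter_eval_def inv_letter_def)
  show ?thesis
    using Cons v a ia
    by (auto simp: cancel_cons_def word_eval_def m_assoc[symmetric])
qed (simp add: cancel_cons_def word_eval_def)

lemma word_eval_foldr:
  "fst ` set u \<subseteq> {1..d} \<Longrightarrow> fst ` set v \<subseteq> {1..d} \<Longrightarrow>
     word_eval G g (foldr cancel_cons u v) = word_eval G g u \<otimes> word_eval G g v"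
proof (induction u)
  case Nil
  then show ?case using word_eval_closed[of v] by (simp add: word_eval_def)
next
  case (Cons a u)
  have a: "fst a \<in> {1..d}" and u: "fst ` set u \<subseteq> {1..d}" using Cons.prems by auto
  have "word_eval G g (foldr cancel_cons (a # u) v) =
      letter_eval G g a \<otimes> (word_eval G g u \<otimes> word_eval G g v)"
    using word_eval_cancel_cons[OF a letters_foldr[OF u Cons.prems(2)]] Cons.IH[OF u Cons.prems(2)]
    by simp
  also have "\<dots> = (letter_eval G g a \<otimes> word_eval G g u) \<otimes> word_eval G g v"
    by (rule m_assoc[symmetric])
       (use a u Cons.prems(2) letter_eval_closed word_eval_closed in blast)+
  also have "letter_eval G g a \<otimes> word_eval G g u = word_eval G g (a # u)"
    by (simp add: word_eval_def)
  finally show ?case .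
qed

lemma word_eval_hom: "word_eval G g \<in> hom (free_group d) G"
proof (rule homI)
  show "word_eval G g u \<in> carrier G" if "u \<in> carrier (free_group d)" for u
    using that by (intro word_eval_closed) (simp add: free_group_def)
  show "word_eval G g (u \<otimes>\<^bsub>free_group d\<^esub> v) = word_eval G g u \<otimes> word_eval G g v"
    if "u \<in> carrier (free_group d)" "v \<in> carrier (free_group d)" for u v
    using that word_eval_foldr[of u v] by (simp add: free_group_def)
qed

lemma word_eval_basis:
  assumes "i \<in> {1..d}"
  shows "word_eval G g (basis_elt i) = g i"
proof -
  have "g i \<in> carrier G" using g assms by blast
  then show ?thesis by (simp add: basis_elt_def word_eval_def letter_eval_def)
qed

lemma word_eval_unique:
  assumes h: "h \<in> hom (free_group d) G"
    and hg: "\<And>i. i \<in> {1..d} \<Longrightarrow> h (basis_elt i) = g i"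
    and w: "w \<in> carrier (free_group d)"
  shows "h w = word_eval G g w"
proof -
  interpret F: group "free_group d" by (rule free_group_group)
  interpret h: group_hom "free_group d" G h
    using h by unfold_locales
  have letter: "h [a] = letter_eval G g a" if a: "fst a \<in> {1..d}" for a
  proof (cases "snd a")
    case True
    then have "[a] = basis_elt (fst a)" by (cases a) (simp add: basis_elt_def)
    then show ?thesis using True hg[OF a] by (simp add: letter_eval_def)
  next
    case False
    then have "[a] = inv\<^bsub>free_group d\<^esub> (basis_elt (fst a))"
      using inv_basis_elt[OF a] by (cases a) simp
    then show ?thesis
      using False hg[OF a] basis_elt_in_carrier[OF a] by (simp add: letter_eval_def)
  qed
  show ?thesis using w
  proof (induction w)
    case Nil
    then show ?case using h.hom_one by (simp add: word_eval_def free_group_def)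
  next
    case (Cons a w)
    have a: "fst a \<in> {1..d}" and w: "w \<in> carrier (free_group d)"
      and a1: "[a] \<in> carrier (free_group d)"
      using Cons.prems by (auto simp: free_group_def reduced_Cons)
    have "[a] \<otimes>\<^bsub>free_group d\<^esub> w = a # w"
      using Cons.prems
      by (auto simp: free_group_def reduced_Cons cancel_cons_def split: list.splits)
    then have "h (a # w) = h [a] \<otimes> h w"
      using h.hom_mult[OF a1 w] by simp
    then show ?case using letter[OF a] Cons.IH[OF w] by (simp add: word_eval_def)
  qed
qed

end


section \<open>Independence of the type of group elements\<close>

lemma word_eval_group_hom:
  assumes "group_hom K G h" and k: "k \<in> {1..d} \<rightarrow> carrier K" and w: "fst ` set w \<subseteq> {1..d}"
  shows "word_eval G (\<lambda>i. h (k i)) w = h (word_eval K k w)"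
proof -
  interpret group_hom K G h by (rule assms(1))
  have le: "letter_eval G (\<lambda>i. h (k i)) a = h (letter_eval K k a)" if "fst a \<in> {1..d}" for a
    using funcset_mem[OF k that] by (simp add: letter_eval_def)
  show ?thesis using w
  proof (induction w)
    case (Cons a w)
    have a: "fst a \<in> {1..d}" and w: "fst ` set w \<subseteq> {1..d}" using Cons.prems by auto
    show ?case
      using Cons.IH[OF w] le[OF a] letter_eval_closed[OF G.group_axioms k a]
        word_eval_closed[OF G.group_axioms k w]
      by (simp add: word_eval_def)
  qed (simp add: word_eval_def)
qed

lemma word_eval_cong:
  assumes "\<And>i. i \<in> {1..d} \<Longrightarrow> g i = g' i" and "fst ` set w \<subseteq> {1..d}"
  shows "word_eval G g w = word_eval G g' w"
  using assms(2)
proof (induction w)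
  case (Cons a w)
  then show ?case using assms(1)[of "fst a"] by (simp add: word_eval_def letter_eval_def)
qed (simp add: word_eval_def)

lemma word_imageI:
  assumes "g \<in> {1..d} \<rightarrow> carrier G" and "fst ` set w \<subseteq> {1..d}"
  shows "word_eval G g w \<in> word_image G d w"
proof -
  have "word_eval G g w = word_eval G (restrict g {1..d}) w"
    by (rule word_eval_cong[OF _ assms(2)]) simp
  moreover have "restrict g {1..d} \<in> {1..d} \<rightarrow>\<^sub>E carrier G" using assms(1) by auto
  ultimately show ?thesis by (auto simp: word_image_def)
qed

lemma countable_subgroup_copy:
  fixes G :: "'g monoid"
  assumes inf: "infinite (UNIV :: 'h set)"
    and G: "group G" and H: "subgroup H G" and cH: "countable H"
  shows "\<exists>(K :: 'h monoid) h. group_hom K G h \<and> bij_betw h (carrier K) H"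
proof -
  interpret group G by (rule G)
  interpret H: subgroup H G by (rule H)
  obtain e :: "nat \<Rightarrow> 'h" where e: "inj e"
    using inf infinite_countable_subset by blast
  define f where "f = e \<circ> to_nat_on H"
  have f: "inj_on f H"
    unfolding f_def using e inj_on_to_nat_on[OF cH] by (simp add: comp_inj_on inj_on_subset)
  define h where "h = inv_into H f"
  have hf: "h (f x) = x" if "x \<in> H" for x using f that by (simp add: h_def)
  define K where
    "K = \<lparr> carrier = f ` H, mult = (\<lambda>a b. f (h a \<otimes>\<^bsub>G\<^esub> h b)), one = f \<one>\<^bsub>G\<^esub> \<rparr>"
  have gK: "group K"
  proof (rule groupI)
    show "\<exists>y\<in>carrier K. y \<otimes>\<^bsub>K\<^esub> x = \<one>\<^bsub>K\<^esub>" if "x \<in> carrier K" for x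
    proof
      show "f (inv\<^bsub>G\<^esub> (h x)) \<in> carrier K" "f (inv\<^bsub>G\<^esub> (h x)) \<otimes>\<^bsub>K\<^esub> x = \<one>\<^bsub>K\<^esub>"
        using that by (auto simp: K_def hf)
    qed
  qed (auto simp: K_def hf m_assoc)
  have "group_hom K G h"
    using gK G by (auto simp: group_hom_def group_hom_axioms_def hom_def K_def hf)
  moreover have "bij_betw h (carrier K) H"
    unfolding K_def by (rule bij_betwI[where g = f]) (auto simp: hf)
  ultimately show ?thesis by blast
qed

lemma word_image_transfer:
  fixes G :: "'g monoid"
  assumes inf: "infinite (UNIV :: 'h set)" and G: "group G"
    and w: "w \<in> carrier (free_group d)" and w': "w' \<in> carrier (free_group d)"
    and x: "x \<in> word_image G d w" "x \<notin> word_image G d w'"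
  shows "\<exists>K :: 'h monoid. group K \<and> word_image K d w \<noteq> word_image K d w'"
proof -
  obtain g where gE: "g \<in> {1..d} \<rightarrow>\<^sub>E carrier G" and xg: "x = word_eval G g w"
    using x(1) by (auto simp: word_image_def)
  then have g: "g \<in> {1..d} \<rightarrow> carrier G" by auto
  interpret E: group_hom "free_group d" G "word_eval G g"
    using free_group_group G word_eval_hom[OF G g]
    by (simp add: group_hom_def group_hom_axioms_def)
  let ?H = "word_eval G g ` carrier (free_group d)"
  have "subgroup ?H G" by (rule E.img_is_subgroup)
  moreover have "countable ?H" by simp
  ultimately obtain K :: "'h monoid" and h
    where hom: "group_hom K G h" and bij: "bij_betw h (carrier K) ?H"
    using countable_subgroup_copy[OF inf G] by blast
  interpret h: group_hom K G h by (rule hom)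
  define k where "k i = inv_into (carrier K) h (g i)" for i
  have gH: "g i \<in> ?H" if "i \<in> {1..d}" for i
    using word_eval_basis[OF G g that] basis_elt_in_carrier[OF that] by (metis imageI)
  have kc: "k i \<in> carrier K" and hk: "h (k i) = g i" if "i \<in> {1..d}" for i
    using gH[OF that] bij unfolding k_def bij_betw_def
    by (metis inv_into_into, metis f_inv_into_f)
  then have k: "k \<in> {1..d} \<rightarrow> carrier K" by blast
  have lw: "fst ` set w \<subseteq> {1..d}" and lw': "fst ` set w' \<subseteq> {1..d}"
    using w w' by (auto simp: free_group_def)
  have "word_eval K k w \<in> word_image K d w"
    by (rule word_imageI[OF k lw])
  moreover have "word_eval K k w \<notin> word_image K d w'"
  proof
    assume "word_eval K k w \<in> word_image K d w'"
    then obtain k' where k': "k' \<in> {1..d} \<rightarrow>\<^sub>E carrier K" and eq: "word_eval K k w = word_eval K k' w'"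
      by (auto simp: word_image_def)
    have k'': "k' \<in> {1..d} \<rightarrow> carrier K" using k' by auto
    have "x = word_eval G (\<lambda>i. h (k i)) w"
      unfolding xg by (rule word_eval_cong[OF _ lw]) (simp add: hk)
    also have "\<dots> = h (word_eval K k w)" by (rule word_eval_group_hom[OF hom k lw])
    also have "\<dots> = word_eval G (\<lambda>i. h (k' i)) w'"
      unfolding eq by (rule word_eval_group_hom[OF hom k'' lw', symmetric])
    also have "\<dots> \<in> word_image G d w'"
      using funcset_mem[OF k''] by (intro word_imageI[OF _ lw'] Pi_I) (blast intro: h.hom_closed)
    finally show False using x(2) by simp
  qed
  ultimately show ?thesis using h.G.group_axioms by blast
qed

lemma gamma_chiral_infinite_type:
  assumes "infinite (UNIV :: 'h set)"
    and "anti_automorphism (free_group d) \<gamma>" and w: "w \<in> carrier (free_group d)"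
    and "gamma_chiral (TYPE('g)) d \<gamma> w"
  shows "gamma_chiral (TYPE('h)) d \<gamma> w"
proof -
  have \<gamma>w: "\<gamma> w \<in> carrier (free_group d)"
    using assms(2) w unfolding anti_automorphism_def bij_betw_def by blast
  obtain G :: "'g monoid" where G: "group G" and "word_image G d w \<noteq> word_image G d (\<gamma> w)"
    using assms(4) unfolding gamma_chiral_def by blast
  then consider x where "x \<in> word_image G d w" "x \<notin> word_image G d (\<gamma> w)"
    | x where "x \<in> word_image G d (\<gamma> w)" "x \<notin> word_image G d w"
    by blast
  then show ?thesis
    unfolding gamma_chiral_def
    using word_image_transfer[OF assms(1) G w \<gamma>w] word_image_transfer[OF assms(1) G \<gamma>w w]
    by cases metis+
qed

end

theory Submission
  imports Defs
begin

text \<open>Precomposing an anti-automorphism \<open>\<gamma>\<close> with inversion gives an automorphism \<open>\<alpha>\<close> with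
  \<open>\<gamma> w = \<alpha> (w\<^sup>-\<^sup>1)\<close>. Word images do not change under automorphisms of the free group, since
  evaluating \<open>\<phi> u\<close> at \<open>g\<close> is evaluating \<open>u\<close> at the values of the \<open>\<phi> x\<^sub>i\<close> at \<open>g\<close>. Hence
  \<open>\<gamma> w\<close> and \<open>w\<^sup>-\<^sup>1\<close> have the same image in every single group.\<close>

text \<open>For an endomorphism only an inclusion can be expected: the tuples \<open>h\<close>
  obtained from some \<open>g\<close> need not exhaust all tuples in \<open>G\<close>.\<close>

lemma word_image_endomorphism_subset:
  fixes G :: "'g monoid"
  assumes G: "group G" and \<phi>: "\<phi> \<in> hom (free_group d) (free_group d)"
    and u: "u \<in> carrier (free_group d)"
  shows "word_image G d (\<phi> u) \<subseteq> word_image G d u"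
proof
  fix x assume "x \<in> word_image G d (\<phi> u)"
  then obtain g where g: "g \<in> {1..d} \<rightarrow> carrier G" and x: "x = word_eval G g (\<phi> u)"
    by (auto simp: word_image_def)
  define h where "h i = word_eval G g (\<phi> (basis_elt i))" for i
  have comp: "word_eval G g \<circ> \<phi> \<in> hom (free_group d) G"
    using \<phi> word_eval_hom[OF G g] by (rule hom_compose)
  have h: "h \<in> {1..d} \<rightarrow> carrier G"
    using hom_in_carrier[OF comp] basis_elt_in_carrier by (auto simp: h_def)
  \<comment> \<open>Two homomorphisms that agree on the basis coincide at \<open>u\<close>.\<close>
  have "x = word_eval G h u"
    using word_eval_unique[OF G h comp _ u] x by (simp add: h_def)
  then show "x \<in> word_image G d u"
    using word_imageI[OF h, of u] u by (simp add: free_group_def)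
qed

text \<open>The inverse of \<open>\<phi>\<close> is again an endomorphism; the inclusion for it at
  \<open>\<phi> u\<close> is the reverse one.\<close>

lemma word_image_automorphism:
  fixes G :: "'g monoid"
  assumes G: "group G" and \<phi>: "\<phi> \<in> iso (free_group d) (free_group d)"
    and u: "u \<in> carrier (free_group d)"
  shows "word_image G d (\<phi> u) = word_image G d u"
proof
  show "word_image G d (\<phi> u) \<subseteq> word_image G d u"
    using word_image_endomorphism_subset[OF G _ u] \<phi> by (simp add: iso_def)
  let ?\<psi> = "inv_into (carrier (free_group d)) \<phi>"
  have "?\<psi> \<in> hom (free_group d) (free_group d)"
    using group.iso_set_sym[OF free_group_group \<phi>] by (simp add: iso_def)
  moreover have "\<phi> u \<in> carrier (free_group d)" and "?\<psi> (\<phi> u) = u"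
    using \<phi> u by (auto simp: iso_def bij_betw_def)
  ultimately show "word_image G d u \<subseteq> word_image G d (\<phi> u)"
    using word_image_endomorphism_subset[OF G, of ?\<psi> d "\<phi> u"] by simp
qed

text \<open>Inversion and \<open>\<gamma>\<close> both reverse products, so the two reversals
  cancel.\<close>

lemma anti_automorphism_comp_inv_iso:
  assumes H: "group H" and \<gamma>: "anti_automorphism H \<gamma>"
  shows "(\<lambda>u. \<gamma> (inv\<^bsub>H\<^esub> u)) \<in> iso H H"
proof -
  interpret group H by (rule H)
  have "bij_betw (\<gamma> \<circ> (\<lambda>u. inv\<^bsub>H\<^esub> u)) (carrier H) (carrier H)"
    using anti_automorphism_inv[OF H] \<gamma> by (auto simp: anti_automorphism_def intro: bij_betw_trans)
  moreover have "(\<lambda>u. \<gamma> (inv\<^bsub>H\<^esub> u)) \<in> hom H H"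
    using \<gamma> by (intro homI) (auto simp: anti_automorphism_def inv_mult_group dest: bij_betwE)
  ultimately show ?thesis by (simp add: iso_def comp_def)
qed

theorem theorem3:
  fixes d :: nat
    and w :: "letter list"
    and \<gamma> :: "letter list \<Rightarrow> letter list"
  assumes "w \<in> carrier (free_group d)"
    and "anti_automorphism (free_group d) \<gamma>"
  shows "chiral TYPE('g) d w \<longleftrightarrow> gamma_chiral TYPE('g) d \<gamma> w"
proof -
  interpret F: group "free_group d" by (rule free_group_group)
  \<comment> \<open>The automorphism is taken at the inverse of \<open>w\<close>, where the double
    inversion leaves \<open>\<gamma> w\<close>.\<close>
  have "word_image G d (\<gamma> w) = word_image G d (inv\<^bsub>free_group d\<^esub> w)"
    if "group G" for G :: "'g monoid"
    using word_image_automorphism[OF that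
        anti_automorphism_comp_inv_iso[OF free_group_group assms(2)] F.inv_closed[OF assms(1)]]
      assms(1) by simp
  then show ?thesis by (auto simp: chiral_def gamma_chiral_def)
qed

end
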